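(* Let $m,n>1$ be coprime integers and let $\phi\in\mathbb F_q[X,Y]$ have coefficient polynomials $\chi_i\in\mathbb F_q[Y]$ $(0\le i\le m-1)$ and $\psi_j\in\mathbb F_q[X]$ $(0\le j\le n-1)$ such that \[\phi(X,Y)=\sum_{i=0}^{m-1}\chi_i(Y)X^i=\sum_{j=0}^{n-1}\psi_j(X)Y^j.\] Let $\mathcal A,\mathcal B\subseteq\overline{\mathbb F}_q$ be Frobenius invariant sets and $(\alpha,\beta)\in\mathcal A^{\mathrm p}_m\times\mathcal B^{\mathrm p}_n$. The $\phi$-product satisfies conjugate cancellation on $(\alpha,\beta)$ if and only if the following properties hold: (i) $\mathbb F_q(\psi_0(\alpha),\psi_1(\alpha),\dots,\psi_{n-1}(\alpha))=\mathbb F_{q^m}$, and (ii) $\mathbb F_q(\chi_0(\beta),\chi_1(\beta),\dots,\chi_{m-1}(\beta))=\mathbb F_{q^n}$.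
   Context: Let $q$ be a prime power and $\overline{\mathbb F}_q$ an algebraic closure of $\mathbb F_q$, with $\mathbb F_{q^n}\subseteq\overline{\mathbb F}_q$. Put $\mathcal F_q(n)=\{\alpha\in\mathbb F_{q^n}:\mathbb F_q(\alpha)=\mathbb F_{q^n}\}$. A set $\mathcal A\subseteq\overline{\mathbb F}_q$ is Frobenius invariant if $\alpha^q\in\mathcal A$ for all $\alpha\in\mathcal A$; put $\mathcal A^{\mathrm p}_m=\mathcal A\cap\mathcal F_q(m)$ (similarly $\mathcal B^{\mathrm p}_n$). A polynomial $\phi\in\mathbb F_q[X,Y]$ induces the $\phi$-product $\alpha\diamond\beta=\phi(\alpha,\beta)$ on $\mathcal A\times\mathcal B$ (which satisfies $(\alpha\diamond\beta)^q=\alpha^q\diamond\beta^q$). The $\phi$-product satisfies conjugate cancellation on $(\alpha,\beta)\in\mathcal A^{\mathrm p}_m\times\mathcal B^{\mathrm p}_n$ if for every integer $k$ with $\gcd(m,n)\mid k$ and all conjugates $\alpha'\in\{\alpha,\alpha^q,\dots,\alpha^{q^{m-1}}\}$, $\beta'\in\{\beta,\beta^q,\dots,\beta^{q^{n-1}}\}$: $\phi(\alpha',\beta')=\phi(\alpha'^{q^k},\beta')$ implies $\alpha'=\alpha'^{q^k}$, and $\phi(\alpha',\beta')=\phi(\alpha',\beta'^{q^k})$ implies $\beta'=\beta'^{q^k}$. (Here $x\mapsto x^{q^k}$ is the $k$-th power of the Frobenius automorphism.) *)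

theory Defs
  imports
    "HOL-Algebra.Algebraic_Closure_Type"
    "HOL-Algebra.Generated_Fields"
    "HOL-Algebra.Sylow"
    "HOL-Library.Cardinality"
begin

text \<open>
  The field $F_q$ is an arbitrary finite field, given as a type of class \<^class>\<open>finite_field\<close>;
  $q$ is the number of its elements, and its algebraic closure is the type constructor
  \<^type>\<open>alg_closure\<close>, with \<^const>\<open>to_ac\<close> as the embedding.
\<close>

section \<open>Subfields of the algebraic closure\<close>

definition adjoin :: "'k::finite_field alg_closure set \<Rightarrow> 'k alg_closure set" where
  "adjoin S = generate_field ring_of_type_algebra (range to_ac \<union> S)"

definition fq_ext :: "nat \<Rightarrow> 'k::finite_field alg_closure set" where
  "fq_ext n = (THE K. subfield K ring_of_type_algebra \<and> card K = CARD('k) ^ n)"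

definition primitive_elements :: "nat \<Rightarrow> 'k::finite_field alg_closure set" where
  "primitive_elements n = {\<alpha> \<in> fq_ext n. adjoin {\<alpha>} = fq_ext n}"

definition prim_part :: "'k::finite_field alg_closure set \<Rightarrow> nat \<Rightarrow> 'k alg_closure set" where
  "prim_part A n = A \<inter> primitive_elements n"


section \<open>The Frobenius automorphism\<close>

definition frob :: "'k::finite_field alg_closure \<Rightarrow> 'k alg_closure" where
  "frob x = x ^ CARD('k)"

text \<open>The exponent ranges over all integers, so that \<open>frob_pow k x\<close> is $x^{q^k}$ also for negative \<open>k\<close>.\<close>

definition frob_pow :: "int \<Rightarrow> 'k::finite_field alg_closure \<Rightarrow> 'k alg_closure" where
  "frob_pow k = (if 0 \<le> k then frob ^^ nat k else inv_into UNIV frob ^^ nat (- k))"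

definition frobenius_invariant :: "'k::finite_field alg_closure set \<Rightarrow> bool" where
  "frobenius_invariant A \<longleftrightarrow> (\<forall>\<alpha>\<in>A. \<alpha> ^ CARD('k) \<in> A)"

definition conjugates :: "nat \<Rightarrow> 'k::finite_field alg_closure \<Rightarrow> 'k alg_closure set" where
  "conjugates n \<alpha> = {\<alpha> ^ (CARD('k) ^ i) | i. i < n}"


section \<open>Bivariate polynomials and the induced product\<close>

text \<open>
  The ring $F_q[X,Y]$ is represented as $F_q[X][Y]$: the outer variable of a polynomial of type
  \<open>'k poly poly\<close> is $Y$, and its coefficients are polynomials in $X$.
\<close>

definition var_X :: "'k::finite_field poly poly" where
  "var_X = [:[:0, 1:]:]"

definition var_Y :: "'k::finite_field poly poly" where
  "var_Y = [:0, 1:]"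

definition in_X :: "'k::finite_field poly \<Rightarrow> 'k poly poly" where
  "in_X p = [:p:]"

definition in_Y :: "'k::finite_field poly \<Rightarrow> 'k poly poly" where
  "in_Y p = map_poly (\<lambda>c. [:c:]) p"

definition phi_product ::
    "'k::finite_field poly poly \<Rightarrow> 'k alg_closure \<Rightarrow> 'k alg_closure \<Rightarrow> 'k alg_closure" where
  "phi_product phi \<alpha> \<beta> = poly (map_poly (\<lambda>c. poly (map_poly to_ac c) \<alpha>) phi) \<beta>"

definition conjugate_cancellation ::
    "'k::finite_field poly poly \<Rightarrow> nat \<Rightarrow> nat \<Rightarrow> 'k alg_closure \<Rightarrow> 'k alg_closure \<Rightarrow> bool" where
  "conjugate_cancellation phi m n \<alpha> \<beta> \<longleftrightarrow>
     (\<forall>k::int. int (gcd m n) dvd k \<longrightarrow>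
       (\<forall>\<alpha>'\<in>conjugates m \<alpha>. \<forall>\<beta>'\<in>conjugates n \<beta>.
         (phi_product phi \<alpha>' \<beta>' = phi_product phi (frob_pow k \<alpha>') \<beta>' \<longrightarrow> \<alpha>' = frob_pow k \<alpha>') \<and>
         (phi_product phi \<alpha>' \<beta>' = phi_product phi \<alpha>' (frob_pow k \<beta>') \<longrightarrow> \<beta>' = frob_pow k \<beta>')))"


section \<open>Evaluation of bivariate polynomials\<close>

lemma poly_map_to_ac_add:
  "poly (map_poly to_ac (p + r)) a = poly (map_poly to_ac p) a + poly (map_poly to_ac r) a"
proof -
  have "map_poly to_ac (p + r) = map_poly to_ac p + map_poly to_ac r"
    by (rule poly_eqI) (simp add: coeff_map_poly)
  thus ?thesis by simp
qed

lemma poly_map_to_ac_smult: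
  "poly (map_poly to_ac (smult c p)) a = to_ac c * poly (map_poly to_ac p) a"
proof -
  have "map_poly to_ac (smult c p) = smult (to_ac c) (map_poly to_ac p)"
    by (rule poly_eqI) (simp add: coeff_map_poly)
  thus ?thesis by simp
qed

lemma poly_map_to_ac_mult:
  "poly (map_poly to_ac (p * r)) a = poly (map_poly to_ac p) a * poly (map_poly to_ac r) a"
proof (induction p)
  case 0
  show ?case by simp
next
  case (pCons c p)
  have "poly (map_poly to_ac (pCons 0 (p * r))) a = a * poly (map_poly to_ac (p * r)) a"
    by (simp add: map_poly_pCons)
  thus ?case
    using pCons
    by (simp add: mult_pCons_left map_poly_pCons poly_map_to_ac_add poly_map_to_ac_smult
                  algebra_simps)
qed

lemma phi_product_0 [simp]: "phi_product 0 a b = 0"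
  by (simp add: phi_product_def)

lemma phi_product_pCons: "phi_product (pCons c f) a b = poly (map_poly to_ac c) a + b * phi_product f a b"
  by (simp add: phi_product_def map_poly_pCons)

lemma phi_product_add: "phi_product (f + g) a b = phi_product f a b + phi_product g a b"
proof -
  have "map_poly (\<lambda>c. poly (map_poly to_ac c) a) (f + g) =
        map_poly (\<lambda>c. poly (map_poly to_ac c) a) f + map_poly (\<lambda>c. poly (map_poly to_ac c) a) g"
    by (rule poly_eqI) (simp add: coeff_map_poly poly_map_to_ac_add)
  thus ?thesis by (simp add: phi_product_def)
qed

lemma phi_product_smult: "phi_product (smult c f) a b = poly (map_poly to_ac c) a * phi_product f a b"
proof -
  have "map_poly (\<lambda>c. poly (map_poly to_ac c) a) (smult c f) =
        smult (poly (map_poly to_ac c) a) (map_poly (\<lambda>c. poly (map_poly to_ac c) a) f)"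
    by (rule poly_eqI) (simp add: coeff_map_poly poly_map_to_ac_mult)
  thus ?thesis by (simp add: phi_product_def)
qed

lemma phi_product_mult: "phi_product (f * g) a b = phi_product f a b * phi_product g a b"
  by (induction f)
     (simp_all add: mult_pCons_left phi_product_add phi_product_smult phi_product_pCons algebra_simps)

lemma phi_product_in_X [simp]: "phi_product (in_X p) a b = poly (map_poly to_ac p) a"
  by (simp add: in_X_def phi_product_pCons)

lemma phi_product_in_Y [simp]: "phi_product (in_Y p) a b = poly (map_poly to_ac p) b"
  by (induction p) (simp_all add: in_Y_def map_poly_pCons phi_product_pCons)

lemma phi_product_var_X [simp]: "phi_product var_X a b = a"
  by (simp add: var_X_def phi_product_pCons map_poly_pCons)

lemma phi_product_var_Y [simp]: "phi_product var_Y a b = b"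
  by (simp add: var_Y_def phi_product_pCons map_poly_pCons)

lemma phi_product_1 [simp]: "phi_product 1 a b = 1"
  by (simp add: one_pCons phi_product_pCons map_poly_pCons)

lemma phi_product_power: "phi_product (f ^ i) a b = phi_product f a b ^ i"
  by (induction i) (simp_all add: phi_product_mult)

lemma phi_product_sum: "phi_product (\<Sum>i\<in>I. f i) a b = (\<Sum>i\<in>I. phi_product (f i) a b)"
  by (induction I rule: infinite_finite_induct) (simp_all add: phi_product_add)


section \<open>Existence and uniqueness of the subfield with $q^n$ elements\<close>

lemma card_finite_field: "\<exists>r>0. CARD('k::finite_field) = CHAR('k) ^ r"
proof -
  define G :: "'k monoid" where "G = \<lparr>carrier = UNIV, monoid.mult = (+), one = 0\<rparr>"
  have G: "group G"
    by (rule groupI) (auto simp: G_def add.assoc intro: exI[of _ "- _"] ab_left_minus)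
  have pow: "x [^]\<^bsub>G\<^esub> (i::nat) = of_nat i * x" for x i
    by (induction i) (auto simp: nat_pow_def G_def algebra_simps)
  have "l = CHAR('k)" if l: "prime l" "l dvd CARD('k)" for l
  proof (rule ccontr)
    assume ne: "l \<noteq> CHAR('k)"
    obtain c where c: "CARD('k) = l * c" using l(2) by (elim dvdE)
    have "\<exists>H. subgroup H G \<and> card H = l ^ 1"
      by (rule sylow_thm[of l G 1 c]) (use l c G in \<open>auto simp: Coset.order_def G_def\<close>)
    then obtain H where H: "subgroup H G" "card H = l" by auto
    have "H \<noteq> {0}" using H(2) l(1) by (auto simp: prime_nat_iff)
    moreover have "0 \<in> H" using subgroup.one_closed[OF H(1)] by (simp add: G_def)
    ultimately obtain x where x: "x \<in> H" "x \<noteq> 0" by blast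
    interpret H: group "G\<lparr>carrier := H\<rparr>"
      using subgroup.subgroup_is_group[OF H(1) G] .
    have "x [^]\<^bsub>G\<lparr>carrier := H\<rparr>\<^esub> Coset.order (G\<lparr>carrier := H\<rparr>) = \<one>\<^bsub>G\<lparr>carrier := H\<rparr>\<^esub>"
      by (rule H.pow_order_eq_1) (use x in auto)
    moreover have "x [^]\<^bsub>G\<lparr>carrier := H\<rparr>\<^esub> Coset.order (G\<lparr>carrier := H\<rparr>) = of_nat l * x"
      using pow[of x l] H(2) by (simp add: Coset.order_def nat_pow_def)
    ultimately have "of_nat l * x = 0" by (simp add: G_def)
    hence "CHAR('k) dvd l" using x(2) by (simp add: of_nat_eq_0_iff_char_dvd)
    thus False using ne l(1) primes_dvd_imp_eq[OF CHAR_prime l(1)] by blast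
  qed
  hence sub: "prime_factors CARD('k) \<subseteq> {CHAR('k)}"
    by (auto simp: in_prime_factors_iff)
  have ne1: "CARD('k) \<noteq> 1"
    by (metis card_1_singletonE UNIV_I singletonD zero_neq_one)
  have "(\<Prod>p\<in>prime_factors CARD('k). p ^ multiplicity p CARD('k)) = CARD('k)"
    by (subst prod_prime_factors) auto
  moreover have "prime_factors CARD('k) = {} \<or> prime_factors CARD('k) = {CHAR('k)}"
    using sub by blast
  ultimately have eq: "CARD('k) = CHAR('k) ^ multiplicity CHAR('k) CARD('k)"
    using ne1 by auto
  hence "multiplicity CHAR('k) CARD('k) \<noteq> 0"
    using ne1 by (metis power_0)
  with eq show ?thesis by blast
qed


lemma CHAR_dvd_card: "CHAR('k::finite_field) dvd CARD('k)"
  using card_finite_field[where ?'k = 'k] by (metis dvd_power)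

lemma power_card_add:
  fixes x y :: "'k::finite_field alg_closure"
  shows "(x + y) ^ (CARD('k) ^ n) = x ^ (CARD('k) ^ n) + y ^ (CARD('k) ^ n)"
proof -
  obtain r where "CARD('k) = CHAR('k) ^ r"
    using card_finite_field by blast
  thus ?thesis
    by (intro freshmans_dream'[where n = "r * n"]) (simp_all add: power_mult)
qed

lemma power_card_uminus:
  fixes x :: "'k::finite_field alg_closure"
  shows "(- x) ^ (CARD('k) ^ n) = - (x ^ (CARD('k) ^ n))"
  using power_card_add[of x "- x" n] by (simp add: power_0_left eq_neg_iff_add_eq_0 add.commute)

lemma power_card_inj:
  fixes x y :: "'k::finite_field alg_closure"
  assumes "x ^ (CARD('k) ^ n) = y ^ (CARD('k) ^ n)"
  shows "x = y"
proof -
  have "(x - y) ^ (CARD('k) ^ n) = 0"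
    using power_card_add[of x "- y" n] assms by (simp add: power_card_uminus)
  thus ?thesis by simp
qed

lemma bij_frob: "bij (frob :: 'k::finite_field alg_closure \<Rightarrow> _)"
proof (rule bijI)
  show "inj (frob :: 'k alg_closure \<Rightarrow> _)"
    by (rule injI) (use power_card_inj[where n = 1] in \<open>simp add: frob_def\<close>)
  show "surj (frob :: 'k alg_closure \<Rightarrow> _)"
    unfolding surj_def frob_def by (metis nth_root_exists zero_less_card_finite)
qed

lemma frob_pow_nat: "frob_pow (int k) x = x ^ (CARD('k) ^ k)" for x :: "'k::finite_field alg_closure"
proof -
  have "(frob ^^ k) x = x ^ (CARD('k) ^ k)"
    by (induction k) (simp_all add: frob_def mult.commute flip: power_mult)
  thus ?thesis by (simp add: frob_pow_def)
qed

lemma frob_pow_minus: "frob_pow (- int k) x ^ (CARD('k) ^ k) = x" for x :: "'k::finite_field alg_closure"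
proof -
  have "(frob ^^ k) ((inv_into UNIV frob ^^ k) x) = x"
  proof (induction k arbitrary: x)
    case (Suc k)
    have "(frob ^^ Suc k) ((inv_into UNIV frob ^^ Suc k) x) =
          (frob ^^ k) (frob (inv_into UNIV frob ((inv_into UNIV frob ^^ k) x)))"
      by (subst funpow_Suc_right) simp
    thus ?case by (simp add: surj_f_inv_f[OF bij_is_surj[OF bij_frob]] Suc.IH)
  qed simp
  thus ?thesis
    using frob_pow_nat[of k "frob_pow (- int k) x"] by (auto simp: frob_pow_def split: if_splits)
qed

lemma subfield_fixed:
  "subfield {x :: 'k::finite_field alg_closure. x ^ (CARD('k) ^ n) = x} ring_of_type_algebra"
    (is "subfield ?R ?L")
proof -
  interpret L: field ?L by (rule field_from_type_algebra)
  have carr: "carrier ?L = UNIV" "monoid.mult ?L = (*)" "add ?L = (+)" "\<one>\<^bsub>?L\<^esub> = 1" "\<zero>\<^bsub>?L\<^esub> = 0"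
    by (simp_all add: ring_of_type_algebra_def)
  have uminus: "\<ominus>\<^bsub>?L\<^esub> x = - x" for x
    by (rule L.minus_equality) (simp_all add: carr)
  have inv: "inv\<^bsub>?L\<^esub> x = inverse x" if "x \<noteq> 0" for x
    by (rule L.comm_inv_char) (use that in \<open>simp_all add: carr\<close>)
  show ?thesis
  proof (rule L.subfieldI')
    show "subring ?R ?L"
      by (rule L.subringI) (auto simp: carr uminus power_card_add power_card_uminus power_mult_distrib)
    show "inv\<^bsub>?L\<^esub> k \<in> ?R" if "k \<in> ?R - {\<zero>\<^bsub>?L\<^esub>}" for k
      using that by (simp add: carr inv power_inverse)
  qed
qed

lemma card_fixed:
  assumes "n > 0"
  shows "card {x :: 'k::finite_field alg_closure. x ^ (CARD('k) ^ n) = x} = CARD('k) ^ n"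
proof -
  define N where "N = CARD('k) ^ n"
  have "CARD('k) > 1"
    using card_finite_field[where ?'k = 'k] CHAR_prime[where ?'a = 'k]
    by (metis one_less_power prime_gt_1_nat)
  hence N: "N > 1" unfolding N_def using assms by (rule one_less_power)
  define p :: "'k alg_closure poly" where "p = monom 1 N - [:0, 1:]"
  have deg: "degree p = N"
    unfolding p_def diff_conv_add_uminus using N
    by (subst degree_add_eq_left) (simp_all add: degree_monom_eq)
  have p0: "p \<noteq> 0" using deg N by auto
  have lead: "lead_coeff p = 1" using N by (simp add: deg) (simp add: p_def coeff_pCons split: nat.split)
  have "(of_nat N :: 'k alg_closure) = 0"
    using CHAR_dvd_card[where ?'k = 'k] assms
    by (simp add: of_nat_eq_0_iff_char_dvd N_def dvd_power_iff_le dvd_trans[OF _ dvd_power])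
  hence deriv: "pderiv p = - 1"
    by (simp add: p_def pderiv_diff pderiv_monom pderiv_pCons one_pCons)
  have roots: "poly p x = 0 \<longleftrightarrow> x ^ N = x" for x
    by (simp add: p_def poly_monom)
  obtain M where M: "size M = N" "p = (\<Prod>x\<in>#M. [:-x, 1:])"
    using alg_closed_imp_factorization[OF p0] deg lead by auto
  have "count M x \<le> 1" for x
  proof (rule ccontr)
    assume "\<not> count M x \<le> 1"
    hence "{#x, x#} \<subseteq># M" by (auto simp: subseteq_mset_def)
    then obtain M' where "M = {#x, x#} + M'" by (metis subset_mset.add_diff_inverse)
    then obtain g where "p = [:-x, 1:] * ([:-x, 1:] * g)" using M(2) by (simp add: mult.assoc)
    hence "poly (pderiv p) x = 0" by (simp add: pderiv_mult del: mult_pCons_left)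
    thus False by (simp add: deriv)
  qed
  hence "M = mset_set (set_mset M)"
    by (intro multiset_eqI) (metis One_nat_def count_eq_zero_iff count_mset_set(1,3) finite_set_mset le_SucE le_zero_eq)
  hence "card (set_mset M) = N" using M(1) by (metis size_mset_set)
  moreover have "set_mset M = {x. x ^ N = x}"
    unfolding roots [symmetric] M(2) by (auto simp: poly_prod_mset prod_mset_zero_iff)
  ultimately show ?thesis by (simp add: N_def)
qed

lemma subfield_card_unique:
  fixes K :: "'k::finite_field alg_closure set"
  assumes "subfield K ring_of_type_algebra" "card K = CARD('k) ^ n" "n > 0"
  shows "K = {x. x ^ (CARD('k) ^ n) = x}"
proof -
  let ?L = "ring_of_type_algebra :: 'k alg_closure ring"
  interpret L: field ?L by (rule field_from_type_algebra)
  have carr: "carrier ?L = UNIV" "monoid.mult ?L = (*)" "add ?L = (+)" "\<one>\<^bsub>?L\<^esub> = 1" "\<zero>\<^bsub>?L\<^esub> = 0"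
    by (simp_all add: ring_of_type_algebra_def)
  have inv: "inv\<^bsub>?L\<^esub> x = inverse x" if "x \<noteq> 0" for x
    by (rule L.comm_inv_char) (use that in \<open>simp_all add: carr\<close>)
  have mult: "x * y \<in> K" if "x \<in> K" "y \<in> K" for x y
    using subringE(6)[OF subfieldE(1)[OF assms(1)]] that by (simp add: carr)
  have inverse: "inverse x \<in> K" if "x \<in> K" "x \<noteq> 0" for x
    using L.subfield_m_inv(1)[OF assms(1), of x] that by (simp add: carr inv)
  have zero: "0 \<in> K" using subringE(2)[OF subfieldE(1)[OF assms(1)]] by (simp add: carr)
  have fin: "finite K" using assms(2) by (intro card_ge_0_finite) simp
  have "x ^ card K = x" if x: "x \<in> K" for x
  proof (cases "x = 0")
    case True
    thus ?thesis using assms(2) by (simp add: power_0_left)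
  next
    case False
    have "x ^ card (K - {0}) * \<Prod>(K - {0}) = (\<Prod>y\<in>K-{0}. x * y)"
      by (simp add: prod.distrib)
    also have "\<dots> = \<Prod>(K - {0})"
      by (rule prod.reindex_bij_witness[of _ "\<lambda>y. inverse x * y" "\<lambda>y. x * y"])
         (use False x mult inverse in auto)
    finally have "x ^ card (K - {0}) = 1" using fin by auto
    moreover have "card K = Suc (card (K - {0}))" using fin zero by (metis card.remove)
    ultimately show ?thesis by simp
  qed
  hence "K \<subseteq> {x. x ^ (CARD('k) ^ n) = x}" using assms(2) by auto
  moreover have "finite {x :: 'k alg_closure. x ^ (CARD('k) ^ n) = x}"
    by (rule card_ge_0_finite) (simp add: card_fixed[OF assms(3)])
  ultimately show ?thesis
    using card_fixed[OF assms(3), where ?'k = 'k] assms(2) by (intro card_subset_eq) auto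
qed

lemma fq_ext_eq:
  assumes "n > 0"
  shows "fq_ext n = {x :: 'k::finite_field alg_closure. x ^ (CARD('k) ^ n) = x}"
  unfolding fq_ext_def
  by (rule the_equality) (use subfield_fixed card_fixed subfield_card_unique assms in blast)+

end

theory Submission
  imports Defs
begin

text \<open>
  Since \<open>m\<close> and \<open>n\<close> are coprime, \<open>\<beta>\<close> still has degree \<open>n\<close> over $F_{q^m}$, so
  \<open>1, \<beta>, \<dots>, \<beta>\<^sup>n\<^sup>-\<^sup>1\<close> are linearly independent over $F_{q^m}$. Comparing coefficients,
  $\phi(\alpha,\beta) = \phi(\alpha^{q^k},\beta)$ holds iff the \<open>k\<close>-th power of the Frobenius
  automorphism fixes every $\psi_j(\alpha)$. Cancellation in the first variable therefore says that
  every power of Frobenius fixing all $\psi_j(\alpha)$ also fixes \<open>\<alpha>\<close>, which by the Galois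
  correspondence for finite fields is condition (i); condition (ii) is the same statement with the
  variables exchanged.
\<close>

section \<open>Powers of Frobenius\<close>

lemma one_less_card: "1 < CARD('k::finite_field)"
  using card_finite_field[where ?'k = 'k] CHAR_prime[where ?'a = 'k]
  by (metis one_less_power prime_gt_1_nat)

lemma to_ac_power_card: "to_ac c ^ (CARD('k) ^ k) = to_ac c" for c :: "'k::finite_field"
  by (simp add: finite_field_power_card_power_eq_same flip: to_ac_power)

lemma power_card_exp_add:
  "x ^ (CARD('k) ^ (i + j)) = (x ^ (CARD('k) ^ i)) ^ (CARD('k) ^ j)"
  for x :: "'k::finite_field alg_closure"
  by (simp add: power_add power_mult)

lemma power_card_commute:
  "(x ^ (CARD('k) ^ i)) ^ (CARD('k) ^ j) = (x ^ (CARD('k) ^ j)) ^ (CARD('k) ^ i)"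
  for x :: "'k::finite_field alg_closure"
  by (simp flip: power_mult add: mult.commute)

lemma power_card_inj_iff [simp]:
  "x ^ (CARD('k) ^ n) = y ^ (CARD('k) ^ n) \<longleftrightarrow> x = y"
  for x y :: "'k::finite_field alg_closure"
  using power_card_inj by blast

lemma power_card_fixed_mult:
  fixes x :: "'k::finite_field alg_closure"
  assumes "x ^ (CARD('k) ^ n) = x"
  shows "x ^ (CARD('k) ^ (n * i)) = x"
  by (induction i) (simp_all add: power_card_exp_add assms)

lemma power_card_fixed_mod:
  fixes x :: "'k::finite_field alg_closure"
  assumes "x ^ (CARD('k) ^ n) = x"
  shows "x ^ (CARD('k) ^ (k mod n)) = x ^ (CARD('k) ^ k)"
proof -
  have "x ^ (CARD('k) ^ (n * (k div n) + k mod n)) = x ^ (CARD('k) ^ (k mod n))"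
    by (simp only: power_card_exp_add power_card_fixed_mult[OF assms])
  thus ?thesis by simp
qed

text \<open>This is the Euclidean algorithm on the exponents: \<open>power_card_fixed_mod\<close>
  supplies each reduction step.\<close>

lemma power_card_fixed_gcd:
  fixes x :: "'k::finite_field alg_closure"
  assumes "x ^ (CARD('k) ^ a) = x" "x ^ (CARD('k) ^ b) = x"
  shows "x ^ (CARD('k) ^ gcd a b) = x"
  using assms
proof (induction a b rule: gcd_nat_induct)
  case (step a b)
  thus ?case using power_card_fixed_mod[of x b a] by (simp add: gcd_red_nat[of a b])
qed simp

lemma power_card_sum:
  fixes f :: "'i \<Rightarrow> 'k::finite_field alg_closure"
  shows "(\<Sum>i\<in>I. f i) ^ (CARD('k) ^ k) = (\<Sum>i\<in>I. f i ^ (CARD('k) ^ k))"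
  by (induction I rule: infinite_finite_induct) (simp_all add: power_card_add power_0_left)

lemma poly_map_to_ac_power_card:
  "poly (map_poly to_ac p) (x ^ (CARD('k) ^ k)) = poly (map_poly to_ac p) x ^ (CARD('k) ^ k)"
  for p :: "'k::finite_field poly"
  by (induction p)
     (simp_all add: map_poly_pCons power_card_add power_mult_distrib to_ac_power_card power_0_left)

text \<open>Cancellation quantifies over integers \<open>k\<close>; this trades each of them,
  negative ones included, for a natural exponent.\<close>

lemma frob_pow_eq_power_mod:
  fixes x :: "'k::finite_field alg_closure"
  assumes "n > 0" "x ^ (CARD('k) ^ n) = x"
  shows "frob_pow k x = x ^ (CARD('k) ^ nat (k mod int n))"
proof (cases "k \<ge> 0")
  case True
  then obtain i where "k = int i" using nonneg_int_cases by blast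
  thus ?thesis
    using power_card_fixed_mod[OF assms(2), of i] by (simp add: frob_pow_nat nat_mod_distrib)
next
  case False
  then obtain i where i: "k = - int i" by (metis int_cases2 of_nat_0_le_iff)
  let ?r = "nat (k mod int n)"
  \<comment> \<open>For \<open>k = - i\<close> the residue of \<open>k\<close> plus \<open>i\<close>
    is a multiple of \<open>n\<close>, so both candidates for the image of \<open>x\<close> have
    \<open>x\<close> as their \<open>i\<close>-th Frobenius image; injectivity identifies
    them.\<close>
  have "int n dvd int (?r + i)" using assms(1) by (simp add: i mod_eq_0_iff_dvd [symmetric] mod_simps)
  then obtain c where c: "?r + i = n * c" by (metis dvdE int_dvd_int_iff)
  have "(x ^ (CARD('k) ^ ?r)) ^ (CARD('k) ^ i) = x"
    unfolding power_card_exp_add [symmetric] c by (rule power_card_fixed_mult[OF assms(2)])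
  also have "\<dots> = frob_pow k x ^ (CARD('k) ^ i)" by (simp add: i frob_pow_minus)
  finally have "(x ^ (CARD('k) ^ ?r)) ^ (CARD('k) ^ i) = frob_pow k x ^ (CARD('k) ^ i)" .
  thus ?thesis by simp
qed


section \<open>Finite subfields of the algebraic closure\<close>

lemma subfield_closed:
  fixes K :: "'k::finite_field alg_closure set"
  assumes "subfield K ring_of_type_algebra"
  shows "0 \<in> K" "1 \<in> K"
    and "\<And>x y. x \<in> K \<Longrightarrow> y \<in> K \<Longrightarrow> x + y \<in> K"
    and "\<And>x y. x \<in> K \<Longrightarrow> y \<in> K \<Longrightarrow> x * y \<in> K"
  using subringE[OF subfieldE(1)[OF assms]] by (simp_all add: ring_of_type_algebra_def)

lemma subfield_adjoin: "subfield (adjoin S) (ring_of_type_algebra :: 'k::finite_field alg_closure ring)"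
  unfolding adjoin_def
  by (rule field.generate_field_is_subfield[OF field_from_type_algebra])
     (simp add: ring_of_type_algebra_def)

lemma range_to_ac_subset_adjoin: "range to_ac \<subseteq> adjoin S"
  by (auto simp: adjoin_def intro: generate_field.incl)

lemma subset_adjoin: "S \<subseteq> adjoin S"
  by (auto simp: adjoin_def intro: generate_field.incl)

lemma adjoin_subset:
  fixes K :: "'k::finite_field alg_closure set"
  assumes "subfield K ring_of_type_algebra" "range to_ac \<subseteq> K" "S \<subseteq> K"
  shows "adjoin S \<subseteq> K"
  unfolding adjoin_def
  by (rule field.generate_field_min_subfield1[OF field_from_type_algebra _ assms(1)])
     (use assms in \<open>auto simp: ring_of_type_algebra_def\<close>)

lemma adjoin_subset_fixed:
  fixes S :: "'k::finite_field alg_closure set"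
  assumes "\<And>x. x \<in> S \<Longrightarrow> x ^ (CARD('k) ^ k) = x"
  shows "adjoin S \<subseteq> {x. x ^ (CARD('k) ^ k) = x}"
  by (rule adjoin_subset[OF subfield_fixed]) (use assms in \<open>auto simp: to_ac_power_card\<close>)

section \<open>Orders of finite subfields\<close>

text \<open>The sum of the $F_q$-space \<open>V\<close> and the line through \<open>x\<close> is
  direct: two representations with different coefficients of \<open>x\<close> could be solved for
  \<open>x\<close> inside \<open>V\<close>.\<close>

lemma card_extend_by_vector:
  fixes V :: "'k::finite_field alg_closure set"
  assumes "finite V"
    and add: "\<And>u v. u \<in> V \<Longrightarrow> v \<in> V \<Longrightarrow> u + v \<in> V"
    and scale: "\<And>c v. v \<in> V \<Longrightarrow> to_ac c * v \<in> V"
    and x: "x \<notin> V"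
  shows "card ((\<lambda>(v, c). v + to_ac c * x) ` (V \<times> UNIV)) = CARD('k) * card V"
proof -
  have "inj_on (\<lambda>(v, c). v + to_ac c * x) (V \<times> UNIV)"
  proof (rule inj_onI, clarsimp)
    fix u c v d
    assume uv: "u \<in> V" "v \<in> V" and eq: "u + to_ac c * x = v + to_ac d * x"
    have "c = d"
    proof (rule ccontr)
      assume "c \<noteq> d"
      \<comment> \<open>The difference is written with the scalar \<open>- 1\<close> so that only
        closure under \<open>add\<close> and \<open>scale\<close> is used.\<close>
      moreover from eq have "to_ac (c - d) * x = v + to_ac (- 1) * u"
        by (simp add: algebra_simps)
      ultimately have "x = to_ac (inverse (c - d)) * (v + to_ac (- 1) * u)"
        by (simp add: field_simps del: to_ac_diff)
      thus False using x uv add scale by metis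
    qed
    with eq show "u = v \<and> c = d" by simp
  qed
  thus ?thesis by (simp add: card_image card_cartesian_product mult.commute)
qed

text \<open>An $F_q$-subspace of \<open>K\<close> of maximal dimension is all of \<open>K\<close>,
  since any vector outside it would enlarge it by a factor $q$.\<close>

lemma card_finite_subfield:
  fixes K :: "'k::finite_field alg_closure set"
  assumes K: "subfield K ring_of_type_algebra" "range to_ac \<subseteq> K" and fin: "finite K"
  obtains d where "d > 0" "card K = CARD('k) ^ d"
proof -
  note closed = subfield_closed[OF K(1)]
  \<comment> \<open>\<open>P V d\<close> says that \<open>V\<close> is an $F_q$-subspace of
    \<open>K\<close> of dimension \<open>d\<close>, the dimension being read off from the
    cardinality.\<close>
  define P where "P V d \<longleftrightarrow> V \<subseteq> K \<and> 0 \<in> V \<and> (\<forall>u\<in>V. \<forall>v\<in>V. u + v \<in> V) \<and>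
    (\<forall>c. \<forall>v\<in>V. to_ac c * v \<in> V) \<and> card V = CARD('k) ^ d" for V :: "'k alg_closure set" and d
  have "\<exists>V. P V 0" by (rule exI[of _ "{0}"]) (simp add: P_def closed)
  moreover have "d \<le> card K" if "\<exists>V. P V d" for d
  proof -
    from that have "CARD('k) ^ d \<le> card K" using card_mono[OF fin] unfolding P_def by metis
    thus ?thesis using power_gt_expt[of "CARD('k)" d] one_less_card[where ?'k = 'k] by simp
  qed
  ultimately obtain d where d: "\<exists>V. P V d" "\<And>e. \<exists>V. P V e \<Longrightarrow> e \<le> d"
    using Nat.ex_has_greatest_nat[of "\<lambda>d. \<exists>V. P V d" 0 "card K"] by blast
  then obtain V where V: "P V d" by blast
  have "V = K"
  proof (rule ccontr)
    assume "V \<noteq> K"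
    then obtain x where x: "x \<in> K" "x \<notin> V" using V by (auto simp: P_def)
    define W where "W = (\<lambda>(v, c). v + to_ac c * x) ` (V \<times> UNIV)"
    have W: "w \<in> W \<longleftrightarrow> (\<exists>v\<in>V. \<exists>c. w = v + to_ac c * x)" for w
      by (auto simp: W_def)
    have "finite V" using V fin finite_subset by (auto simp: P_def)
    hence "card W = CARD('k) * card V"
      unfolding W_def by (rule card_extend_by_vector) (use V x in \<open>auto simp: P_def\<close>)
    moreover have "v + to_ac c * x \<in> K" if "v \<in> V" for v c
      using that V x(1) K(2) by (intro closed) (auto simp: P_def)
    hence "W \<subseteq> K" by (auto simp: W)
    moreover have "0 \<in> W"
      unfolding W using V by (intro bexI[of _ 0] exI[of _ 0]) (auto simp: P_def)
    moreover have "u + w \<in> W" if u: "u \<in> W" and w: "w \<in> W" for u w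
    proof -
      obtain u' c w' e where "u' \<in> V" "w' \<in> V" "u = u' + to_ac c * x" "w = w' + to_ac e * x"
        using u w W by metis
      thus ?thesis unfolding W using V
        by (intro bexI[of _ "u' + w'"] exI[of _ "c + e"]) (auto simp: P_def algebra_simps)
    qed
    moreover have "to_ac e * w \<in> W" if w: "w \<in> W" for e w
    proof -
      obtain w' c where "w' \<in> V" "w = w' + to_ac c * x" using w W by metis
      thus ?thesis unfolding W using V
        by (intro bexI[of _ "to_ac e * w'"] exI[of _ "e * c"]) (auto simp: P_def algebra_simps)
    qed
    ultimately have "P W (Suc d)" using V by (simp add: P_def)
    thus False using d(2) by fastforce
  qed
  hence card: "card K = CARD('k) ^ d" using V by (simp add: P_def)
  \<comment> \<open>Excludes \<open>d = 0\<close>, where \<open>K\<close> would have a single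
    element.\<close>
  moreover have "card {0, 1 :: 'k alg_closure} \<le> card K"
    using closed by (intro card_mono fin) auto
  ultimately have "d > 0" by (cases d) auto
  thus ?thesis using card that by blast
qed

section \<open>Galois correspondence and Frobenius periods\<close>

text \<open>The finite field \<open>adjoin S\<close> has order $q^d$ for some \<open>d\<close>, so
  it is the fixed field of the \<open>d\<close>-th Frobenius power. The criterion at
  \<open>k = d\<close> then puts the generator \<alpha> of \<open>fq_ext m\<close> into it.\<close>

lemma adjoin_eq_fq_ext_iff:
  fixes \<alpha> :: "'k::finite_field alg_closure" and S :: "'k alg_closure set"
  assumes m: "m > 0" and \<alpha>: "\<alpha> \<in> primitive_elements m" and S: "S \<subseteq> fq_ext m"
  shows "adjoin S = fq_ext m \<longleftrightarrow>
    (\<forall>k. (\<forall>s\<in>S. s ^ (CARD('k) ^ k) = s) \<longrightarrow> \<alpha> ^ (CARD('k) ^ k) = \<alpha>)"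
proof (intro iffI allI impI)
  fix k assume "adjoin S = fq_ext m" "\<forall>s\<in>S. s ^ (CARD('k) ^ k) = s"
  thus "\<alpha> ^ (CARD('k) ^ k) = \<alpha>"
    using adjoin_subset_fixed[of S k] \<alpha> by (auto simp: primitive_elements_def)
next
  assume fixed: "\<forall>k. (\<forall>s\<in>S. s ^ (CARD('k) ^ k) = s) \<longrightarrow> \<alpha> ^ (CARD('k) ^ k) = \<alpha>"
  have sub: "adjoin S \<subseteq> fq_ext m"
    using adjoin_subset_fixed[of S m] S by (auto simp: fq_ext_eq[OF m])
  have "finite (fq_ext m :: 'k alg_closure set)"
    by (rule card_ge_0_finite) (simp add: fq_ext_eq m card_fixed)
  hence "finite (adjoin S)" using sub finite_subset by blast
  then obtain d where d: "d > 0" "card (adjoin S) = CARD('k) ^ d"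
    using card_finite_subfield[OF subfield_adjoin range_to_ac_subset_adjoin] by blast
  have eq: "adjoin S = {x. x ^ (CARD('k) ^ d) = x}"
    using subfield_card_unique[OF subfield_adjoin d(2,1)] .
  hence "\<alpha> \<in> adjoin S" using fixed subset_adjoin[of S] by auto
  hence "adjoin {\<alpha>} \<subseteq> adjoin S"
    by (intro adjoin_subset[OF subfield_adjoin range_to_ac_subset_adjoin]) simp
  thus "adjoin S = fq_ext m" using sub \<alpha> by (auto simp: primitive_elements_def)
qed

text \<open>If the \<open>k\<close>-th Frobenius power fixes \<beta>, so does the power with
  exponent \<open>gcd k n\<close>. Its fixed field then contains all of \<open>fq_ext n\<close>, and
  counting elements forces \<open>gcd k n = n\<close>.\<close>

lemma primitive_power_card_eq_iff:
  fixes \<beta> :: "'k::finite_field alg_closure"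
  assumes n: "n > 0" and \<beta>: "\<beta> \<in> primitive_elements n"
  shows "\<beta> ^ (CARD('k) ^ k) = \<beta> \<longleftrightarrow> n dvd k"
proof
  have fixn: "\<beta> ^ (CARD('k) ^ n) = \<beta>"
    using \<beta> by (simp add: primitive_elements_def fq_ext_eq n)
  show "n dvd k" if "\<beta> ^ (CARD('k) ^ k) = \<beta>"
  proof -
    let ?d = "gcd k n"
    have d: "?d > 0" using n by simp
    have "\<beta> ^ (CARD('k) ^ ?d) = \<beta>" using power_card_fixed_gcd[OF that fixn] .
    hence "adjoin {\<beta>} \<subseteq> {x. x ^ (CARD('k) ^ ?d) = x}" by (intro adjoin_subset_fixed) auto
    hence "{x :: 'k alg_closure. x ^ (CARD('k) ^ n) = x} \<subseteq> {x. x ^ (CARD('k) ^ ?d) = x}"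
      using \<beta> by (simp add: primitive_elements_def fq_ext_eq n)
    moreover have "finite {x :: 'k alg_closure. x ^ (CARD('k) ^ ?d) = x}"
      by (rule card_ge_0_finite) (simp add: card_fixed[OF d])
    ultimately have "card {x :: 'k alg_closure. x ^ (CARD('k) ^ n) = x} \<le>
        card {x :: 'k alg_closure. x ^ (CARD('k) ^ ?d) = x}"
      by (intro card_mono)
    hence "CARD('k) ^ n \<le> CARD('k) ^ ?d"
      unfolding card_fixed[OF n] card_fixed[OF d] .
    hence "n \<le> ?d" using one_less_card[where ?'k = 'k] by simp
    hence "?d = n" using n by (simp add: dvd_imp_le le_antisym)
    thus ?thesis by (metis gcd_dvd1)
  qed
  show "\<beta> ^ (CARD('k) ^ k) = \<beta>" if "n dvd k"
    using that by (elim dvdE) (simp only: power_card_fixed_mult[OF fixn])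
qed


section \<open>Cancellation in one variable\<close>

text \<open>
  A nontrivial relation would be a polynomial of degree below \<open>n\<close> over $F_{q^m}$ that vanishes at
  \<open>b\<close>, hence at the images of \<open>b\<close> under all powers of $x \mapsto x^{q^m}$; as \<open>m\<close> is coprime
  to \<open>n\<close>, there are \<open>n\<close> of them.
\<close>

lemma powers_independent_over_fq_ext:
  fixes b :: "'k::finite_field alg_closure"
  assumes cop: "coprime m n"
    and order: "\<And>k. b ^ (CARD('k) ^ k) = b \<Longrightarrow> n dvd k"
    and c: "\<And>j. j < n \<Longrightarrow> c j ^ (CARD('k) ^ m) = c j"
    and zero: "(\<Sum>j<n. c j * b ^ j) = 0"
    and j: "j < n"
  shows "c j = 0"
proof (rule ccontr)
  assume "c j \<noteq> 0"
  define p where "p = (\<Sum>j<n. monom (c j) j)"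
  have coeff: "coeff p i = (if i < n then c i else 0)" for i
    by (simp add: p_def coeff_sum coeff_monom)
  have "p \<noteq> 0" using \<open>c j \<noteq> 0\<close> j coeff[of j] by auto
  have "degree p < n" using j by (intro le_less_trans[OF degree_le[of "n - 1"]]) (auto simp: coeff)
  let ?r = "\<lambda>i. b ^ (CARD('k) ^ (m * i))"
  have "inj_on ?r {..<n}"
  proof (rule linorder_inj_onI)
    fix i i' assume i: "i < i'" "i \<in> {..<n}" "i' \<in> {..<n}"
    show "?r i \<noteq> ?r i'"
    proof
      assume "?r i = ?r i'"
      moreover have "m * i' = m * (i' - i) + m * i"
        using i by (simp flip: distrib_left)
      \<comment> \<open>The common outer power with exponent \<open>m * i\<close> cancels, because
        Frobenius powers are injective.\<close>
      ultimately have "b = ?r (i' - i)" by (simp only: power_card_exp_add power_card_inj_iff)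
      hence "n dvd m * (i' - i)" using order by metis
      hence "n dvd i' - i" using cop by (simp add: coprime_dvd_mult_right_iff coprime_commute)
      thus False using i by (auto dest: dvd_imp_le)
    qed
  qed auto
  hence "card (?r ` {..<n}) = n" by (simp add: card_image)
  moreover have "?r ` {..<n} \<subseteq> {x. poly p x = 0}"
  proof clarify
    fix i
    have "poly p (?r i) = (\<Sum>j<n. c j * b ^ j) ^ (CARD('k) ^ (m * i))"
      unfolding p_def poly_sum power_card_sum
      by (intro sum.cong)
         (simp_all add: poly_monom power_mult_distrib power_card_fixed_mult c power_commutes
            flip: power_mult, simp add: mult.commute)
    thus "poly p (?r i) = 0" by (simp add: zero power_0_left)
  qed
  ultimately have "n \<le> card {x. poly p x = 0}"
    using card_mono poly_roots_finite[OF \<open>p \<noteq> 0\<close>] by metis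
  thus False using card_poly_roots_bound[OF \<open>p \<noteq> 0\<close>] \<open>degree p < n\<close> by simp
qed

text \<open>Stated for a bare sum \<open>F\<close> in powers of its second argument, so that it
  serves both variables of the product after exchanging the roles of \<alpha> and \<beta>.\<close>

lemma cancellation_iff_adjoin:
  fixes \<alpha> \<beta> :: "'k::finite_field alg_closure" and f :: "nat \<Rightarrow> 'k poly"
  assumes mn: "m > 0" "n > 0" "coprime m n"
    and \<alpha>: "\<alpha> \<in> primitive_elements m" and \<beta>: "\<beta> \<in> primitive_elements n"
  defines "F \<equiv> \<lambda>x y. \<Sum>j<n. poly (map_poly to_ac (f j)) x * y ^ j"
  shows "(\<forall>k. \<forall>a\<in>conjugates m \<alpha>. \<forall>b\<in>conjugates n \<beta>. F a b = F (frob_pow k a) b \<longrightarrow> a = frob_pow k a) \<longleftrightarrow>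
    adjoin {poly (map_poly to_ac (f j)) \<alpha> | j. j < n} = fq_ext m" (is "?cancel \<longleftrightarrow> adjoin ?S = _")
proof -
  let ?f = "\<lambda>j x. poly (map_poly to_ac (f j)) x"
  have \<alpha>m: "\<alpha> ^ (CARD('k) ^ m) = \<alpha>" using \<alpha> by (simp add: primitive_elements_def fq_ext_eq mn)
  have conj_fixed: "a ^ (CARD('k) ^ m) = a" if "a \<in> conjugates m \<alpha>" for a
    using that by (auto simp: conjugates_def power_card_commute[of \<alpha> _ m] \<alpha>m)
  \<comment> \<open>The right-hand side mentions neither \<open>a\<close> nor \<open>b\<close>: all
    conjugate pairs give the same condition on \<open>k\<close>.\<close>
  have F_eq: "F a b = F (a ^ (CARD('k) ^ k)) b \<longleftrightarrow> (\<forall>s\<in>?S. s ^ (CARD('k) ^ k) = s)"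
    if a: "a \<in> conjugates m \<alpha>" and b: "b \<in> conjugates n \<beta>" for a b k
  proof -
    obtain i where i: "a = \<alpha> ^ (CARD('k) ^ i)" using a by (auto simp: conjugates_def)
    obtain l where l: "b = \<beta> ^ (CARD('k) ^ l)" using b by (auto simp: conjugates_def)
    have order: "n dvd r" if "b ^ (CARD('k) ^ r) = b" for r
      using that primitive_power_card_eq_iff[OF mn(2) \<beta>]
      by (simp add: l power_card_commute[of \<beta> l])
    \<comment> \<open>These are the coefficients of the difference of the two values, expanded in
      powers of \<open>b\<close>; they lie in $F_{q^m}$, so the independence lemma applies.\<close>
    define c where "c j = ?f j a - ?f j a ^ (CARD('k) ^ k)" for j
    have c_fixed: "c j ^ (CARD('k) ^ m) = c j" for j
      unfolding c_def diff_conv_add_uminus power_card_add power_card_uminus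
      by (simp add: power_card_commute[of _ k m] conj_fixed[OF a] flip: poly_map_to_ac_power_card)
    have "F a b - F (a ^ (CARD('k) ^ k)) b = (\<Sum>j<n. c j * b ^ j)"
      by (simp add: F_def c_def poly_map_to_ac_power_card sum_subtractf left_diff_distrib)
    hence "F a b = F (a ^ (CARD('k) ^ k)) b \<longleftrightarrow> (\<Sum>j<n. c j * b ^ j) = 0"
      by (metis eq_iff_diff_eq_0)
    also have "\<dots> \<longleftrightarrow> (\<forall>j<n. c j = 0)"
      by (auto intro: powers_independent_over_fq_ext[OF mn(3) order c_fixed])
    \<comment> \<open>Here \<open>a\<close> is the \<open>i\<close>-th Frobenius image of \<alpha>,
      and that power commutes with the \<open>k\<close>-th one and is injective.\<close>
    also have "\<dots> \<longleftrightarrow> (\<forall>j<n. ?f j \<alpha> ^ (CARD('k) ^ k) = ?f j \<alpha>)"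
      by (simp add: c_def i poly_map_to_ac_power_card power_card_commute[of _ i k]
          eq_commute[of "poly _ _"])
    finally show ?thesis by auto
  qed
  have fix_eq: "a ^ (CARD('k) ^ k) = a \<longleftrightarrow> \<alpha> ^ (CARD('k) ^ k) = \<alpha>" if "a \<in> conjugates m \<alpha>" for a k
    using that by (auto simp: conjugates_def power_card_commute[of \<alpha> _ k])
  have ex: "\<alpha> \<in> conjugates m \<alpha>" "\<beta> \<in> conjugates n \<beta>"
    using mn by (auto simp: conjugates_def intro!: exI[of _ 0])
  have "?S \<subseteq> fq_ext m"
    using mn(1) by (auto simp: fq_ext_eq \<alpha>m simp flip: poly_map_to_ac_power_card)
  hence "adjoin ?S = fq_ext m \<longleftrightarrow>
    (\<forall>k. (\<forall>s\<in>?S. s ^ (CARD('k) ^ k) = s) \<longrightarrow> \<alpha> ^ (CARD('k) ^ k) = \<alpha>)"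
    using adjoin_eq_fq_ext_iff[OF mn(1) \<alpha>] by blast
  also have "\<dots> \<longleftrightarrow> ?cancel"
  proof (intro iffI allI ballI impI)
    fix k a b
    assume *: "\<forall>k. (\<forall>s\<in>?S. s ^ (CARD('k) ^ k) = s) \<longrightarrow> \<alpha> ^ (CARD('k) ^ k) = \<alpha>"
      and a: "a \<in> conjugates m \<alpha>" and b: "b \<in> conjugates n \<beta>" and eq: "F a b = F (frob_pow k a) b"
    define r where "r = nat (k mod int m)"
    have frob: "frob_pow k a = a ^ (CARD('k) ^ r)"
      unfolding r_def using frob_pow_eq_power_mod[OF mn(1) conj_fixed[OF a]] .
    have "\<forall>s\<in>?S. s ^ (CARD('k) ^ r) = s"
      using eq unfolding frob F_eq[OF a b] .
    with * have "\<alpha> ^ (CARD('k) ^ r) = \<alpha>" by blast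
    hence "a ^ (CARD('k) ^ r) = a" unfolding fix_eq[OF a] .
    thus "a = frob_pow k a" unfolding frob by (rule sym)
  next
    fix k
    assume cancel: ?cancel and fixed: "\<forall>s\<in>?S. s ^ (CARD('k) ^ k) = s"
    \<comment> \<open>For this direction cancellation is instantiated at the pair (\<alpha>,
      \<beta>) itself.\<close>
    have "F \<alpha> \<beta> = F (frob_pow (int k) \<alpha>) \<beta>"
      unfolding frob_pow_nat F_eq[OF ex] using fixed .
    hence "\<alpha> = frob_pow (int k) \<alpha>" using cancel ex by blast
    thus "\<alpha> ^ (CARD('k) ^ k) = \<alpha>" by (simp add: frob_pow_nat)
  qed
  finally show ?thesis by blast
qed

theorem theorem3p6:
  fixes phi :: "'k::finite_field poly poly"
    and chi psi :: "nat \<Rightarrow> 'k poly"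
    and m n :: nat
    and A B :: "'k alg_closure set"
    and \<alpha> \<beta> :: "'k alg_closure"
  assumes "m > 1" and "n > 1" and "coprime m n"
    and "phi = (\<Sum>i<m. in_Y (chi i) * var_X ^ i)"
    and "phi = (\<Sum>j<n. in_X (psi j) * var_Y ^ j)"
    and "frobenius_invariant A" and "frobenius_invariant B"
    and "(\<alpha>, \<beta>) \<in> prim_part A m \<times> prim_part B n"
  shows "conjugate_cancellation phi m n \<alpha> \<beta> \<longleftrightarrow>
           adjoin {poly (map_poly to_ac (psi j)) \<alpha> | j. j < n} = fq_ext m \<and>
           adjoin {poly (map_poly to_ac (chi i)) \<beta> | i. i < m} = fq_ext n"
proof -
  have \<alpha>\<beta>: "\<alpha> \<in> primitive_elements m" "\<beta> \<in> primitive_elements n"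
    using assms(8) by (auto simp: prim_part_def)
  have "phi_product phi x y = (\<Sum>j<n. poly (map_poly to_ac (psi j)) x * y ^ j)" for x y
    by (simp add: assms(5) phi_product_sum phi_product_mult phi_product_power)
  moreover have "phi_product phi x y = (\<Sum>i<m. poly (map_poly to_ac (chi i)) y * x ^ i)" for x y
    by (simp add: assms(4) phi_product_sum phi_product_mult phi_product_power)
  \<comment> \<open>One function, expanded in powers of each argument: the first form yields (i),
    the second yields (ii).\<close>
  ultimately have phi: "phi_product phi = (\<lambda>x y. \<Sum>j<n. poly (map_poly to_ac (psi j)) x * y ^ j)"
    "phi_product phi = (\<lambda>x y. \<Sum>i<m. poly (map_poly to_ac (chi i)) y * x ^ i)"
    by (intro ext; simp)+
  have "(\<forall>k. \<forall>a\<in>conjugates m \<alpha>. \<forall>b\<in>conjugates n \<beta>.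
          phi_product phi a b = phi_product phi (frob_pow k a) b \<longrightarrow> a = frob_pow k a) \<longleftrightarrow>
        adjoin {poly (map_poly to_ac (psi j)) \<alpha> | j. j < n} = fq_ext m"
    unfolding phi(1) by (rule cancellation_iff_adjoin) (use assms(1-3) \<alpha>\<beta> in auto)
  moreover have "(\<forall>k. \<forall>b\<in>conjugates n \<beta>. \<forall>a\<in>conjugates m \<alpha>.
          phi_product phi a b = phi_product phi a (frob_pow k b) \<longrightarrow> b = frob_pow k b) \<longleftrightarrow>
        adjoin {poly (map_poly to_ac (chi i)) \<beta> | i. i < m} = fq_ext n"
    unfolding phi(2)
    by (rule cancellation_iff_adjoin) (use assms(1-3) \<alpha>\<beta> in \<open>auto simp: coprime_commute\<close>)
  \<comment> \<open>Coprimality makes the gcd 1, so the definition admits every integer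
    \<open>k\<close>, as \<open>cancellation_iff_adjoin\<close> does.\<close>
  moreover have "int (gcd m n) dvd k \<longleftrightarrow> True" for k
    using assms(3) by simp
  ultimately show ?thesis
    unfolding conjugate_cancellation_def by (simp only: simp_thms ball_conj_distrib all_conj_distrib) blast
qed

end
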